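(* The asymmetric shelf shuffle is not closed under repeated shuffling: there exist integers $n,m\ge1$ and $p\in(0,1)$ such that the law $\nu_{n,m}^{(p)}*\nu_{n,m}^{(p)}$ of the permutation obtained by performing the $(m,p)$-shelf shuffle twice (independently) is not equal to $\nu_{n,m'}^{(s)}$ for any integer $m'\ge1$ and any $s\in(0,1)$.
   Context: $(m,p)$-shelf shuffle: a deck of cards labelled $1,\ldots,n$, arranged in increasing order from top to bottom, is dealt sequentially from the bottom (so the cards are dealt in the order $n,n-1,\ldots,1$). Each card is assigned one of $m$ labelled shelves, independently and uniformly at random, and is placed at the top of the existing pile on that shelf with probability $p$ and at the bottom of it with probability $1-p$, independently of everything else (a card assigned to an empty shelf simply starts the pile). The shuffled deck is formed by joining the piles in the order of the shelves $1,\ldots,m$, and is read from top to bottom as a permutation $\pi=(\pi_1,\ldots,\pi_n)\in S_n$ in one-line notation. The law of this random permutation is denoted $\nu_{n,m}^{(p)}$. For a probability measure $\nu$ on $S_n$, the convolution is $(\nu*\nu)(\pi)=\sum_{\sigma,\tau\in S_n:\ \sigma\tau=\pi}\nu(\sigma)\nu(\tau)$. *)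

theory Defs
  imports "HOL-Probability.Probability" "HOL-Combinatorics.Permutations"
begin

text \<open>A pile is a list of cards read from top to bottom; \<open>P j\<close> is the pile on shelf \<open>j\<close>.
  Both branches put a card dealt to an empty shelf as the single card of its pile.\<close>

definition place_card :: "nat \<Rightarrow> nat \<Rightarrow> bool \<Rightarrow> (nat \<Rightarrow> nat list) \<Rightarrow> (nat \<Rightarrow> nat list)" where
  "place_card c j on_top P = P(j := (if on_top then c # P j else P j @ [c]))"

definition deal_card :: "nat \<Rightarrow> real \<Rightarrow> nat \<Rightarrow> (nat \<Rightarrow> nat list) \<Rightarrow> (nat \<Rightarrow> nat list) pmf" where
  "deal_card m p c P =
     bind_pmf (pmf_of_set {1..m}) (\<lambda>j.
     bind_pmf (bernoulli_pmf p) (\<lambda>on_top.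
     return_pmf (place_card c j on_top P)))"

primrec deal_cards :: "nat \<Rightarrow> real \<Rightarrow> nat list \<Rightarrow> (nat \<Rightarrow> nat list) \<Rightarrow> (nat \<Rightarrow> nat list) pmf" where
  "deal_cards m p [] P = return_pmf P"
| "deal_cards m p (c # cs) P = bind_pmf (deal_card m p c P) (deal_cards m p cs)"

definition join_piles :: "nat \<Rightarrow> (nat \<Rightarrow> nat list) \<Rightarrow> nat list" where
  "join_piles m P = concat (map P [1..<m + 1])"

text \<open>The permutation with one-line notation \<open>xs\<close>, where positions are counted from 1;
  it is extended by the identity, as \<^const>\<open>permutes\<close> requires.\<close>

definition perm_of_one_line :: "nat list \<Rightarrow> nat \<Rightarrow> nat" where
  "perm_of_one_line xs i = (if i \<in> {1..length xs} then xs ! (i - 1) else i)"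

text \<open>The law of the \<open>(m, p)\<close>-shelf shuffle of \<open>n\<close> cards, meaningful for \<open>m \<ge> 1\<close> and
  \<open>0 \<le> p \<le> 1\<close>. The cards are dealt from the bottom, in the order \<open>n, n - 1, \<dots>, 1\<close>.\<close>

definition shelf_shuffle :: "nat \<Rightarrow> nat \<Rightarrow> real \<Rightarrow> (nat \<Rightarrow> nat) pmf" where
  "shelf_shuffle n m p =
     map_pmf (\<lambda>P. perm_of_one_line (join_piles m P))
       (deal_cards m p (rev [1..<n + 1]) (\<lambda>_. []))"

text \<open>Permutations are multiplied by composition. For the convolution of a law with itself the
  order of the factors is immaterial.\<close>

definition perm_convolution ::
    "nat \<Rightarrow> (nat \<Rightarrow> nat) pmf \<Rightarrow> (nat \<Rightarrow> nat) pmf \<Rightarrow> (nat \<Rightarrow> nat) \<Rightarrow> real" where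
  "perm_convolution n \<mu> \<nu> \<pi> =
     (\<Sum>(\<sigma>, \<tau>) \<in> {(\<sigma>, \<tau>). \<sigma> permutes {1..n} \<and> \<tau> permutes {1..n} \<and> \<sigma> \<circ> \<tau> = \<pi>}.
        pmf \<mu> \<sigma> * pmf \<nu> \<tau>)"

end

theory Submission
  imports Defs
begin

text \<open>
  Two shuffles of three cards with a single shelf already form a law that no shelf shuffle has.
  Only the probability of the permutation 213 is compared.

  Under the \<open>(m, s)\<close>-shelf shuffle this probability is \<open>(1 - 1 / m\<^sup>2) / 6\<close>, whatever \<open>s\<close> is. The
  deck 213 can only come from shelves \<open>j\<^sub>2 \<le> j\<^sub>1 \<le> j\<^sub>3\<close> of the cards 2, 1, 3. If the shelves are
  distinct, 213 is certain. If \<open>j\<^sub>2 = j\<^sub>1 < j\<^sub>3\<close>, card 1 must go to the bottom, with probability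
  \<open>1 - s\<close>; if \<open>j\<^sub>2 < j\<^sub>1 = j\<^sub>3\<close>, it must go to the top, with probability \<open>s\<close>. The three cards cannot
  share a shelf, because within a pile the labels decrease from the largest card outwards, whereas
  card 1 lies between cards 2 and 3 in 213. The two mixed cases have equally
  many shelf assignments, so \<open>s\<close> cancels and the total weight is
  \<open>(m choose 3) + (m choose 2) = ((m + 1) choose 3)\<close> out of \<open>m\<^sup>3\<close>
  (lemma \<open>pmf_shelf_shuffle_213\<close>).

  After two \<open>(1, p)\<close>-shuffles the probability of 213 is \<open>p (1 - p)\<^sup>2\<close>
  (lemma \<open>perm_convolution_one_shelf_213\<close>). Equality with a shelf shuffle on \<open>m\<close> shelves would thus
  force \<open>1 / m\<^sup>2 = 1 - 6 p (1 - p)\<^sup>2\<close>. For \<open>p = 3/4\<close> the right-hand side is \<open>23/32\<close>, strictly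
  between \<open>1/4\<close> and \<open>1\<close>, which no integer \<open>m\<close> achieves. For \<open>p = 1/2\<close> it would be \<open>1/4\<close>, which
  is compatible with two shelves.
\<close>

section \<open>Permutations in one-line notation\<close>

lemma perm_of_one_line_eq_iff:
  assumes "length xs = length ys"
  shows "perm_of_one_line xs = perm_of_one_line ys \<longleftrightarrow> xs = ys"
proof
  assume eq: "perm_of_one_line xs = perm_of_one_line ys"
  show "xs = ys"
  proof (rule nth_equalityI)
    fix i assume "i < length xs"
    then show "xs ! i = ys ! i"
      using fun_cong[OF eq, of "Suc i"] assms by (simp add: perm_of_one_line_def)
  qed (fact assms)
qed simp

lemma perm_of_one_line_permutes:
  assumes "distinct xs" "set xs = {1..length xs}"
  shows "perm_of_one_line xs permutes {1..length xs}"
proof (rule bij_imp_permutes)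
  have "perm_of_one_line xs ` {1..length xs} = set xs"
  proof -
    have "perm_of_one_line xs ` {1..length xs} = perm_of_one_line xs ` Suc ` {..<length xs}"
      by (simp add: image_Suc_lessThan)
    also have "\<dots> = (\<lambda>i. xs ! i) ` {..<length xs}"
      unfolding image_image by (rule image_cong) (auto simp: perm_of_one_line_def)
    also have "\<dots> = set xs"
      by (auto simp: set_conv_nth)
    finally show ?thesis .
  qed
  then show "bij_betw (perm_of_one_line xs) {1..length xs} {1..length xs}"
    using assms by (auto simp: bij_betw_def intro: eq_card_imp_inj_on)
qed (auto simp: perm_of_one_line_def)

lemma perm_of_one_line_comp:
  assumes "length xs = length ys" "set ys \<subseteq> {1..length ys}"
  shows "perm_of_one_line xs \<circ> perm_of_one_line ys =
           perm_of_one_line (map (\<lambda>i. xs ! (i - 1)) ys)"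
proof
  fix i
  show "(perm_of_one_line xs \<circ> perm_of_one_line ys) i =
          perm_of_one_line (map (\<lambda>i. xs ! (i - 1)) ys) i"
  proof (cases "i \<in> {1..length ys}")
    case True
    then have "ys ! (i - 1) \<in> {1..length ys}"
      by (intro subsetD[OF assms(2)] nth_mem) auto
    moreover have "i - 1 < length ys"
      using True by auto
    ultimately show ?thesis
      using True assms(1) by (simp add: perm_of_one_line_def)
  next
    case False
    then have "perm_of_one_line ys i = i" "perm_of_one_line zs i = i" if "length zs = length ys" for zs
      using that by (simp_all only: perm_of_one_line_def if_False)
    with assms(1) show ?thesis
      by simp
  qed
qed

section \<open>The dealing process\<close>

lemma pmf_map_deal_cards_Nil:
  "pmf (map_pmf g (deal_cards m p [] P)) x = of_bool (g P = x)"
  by (simp add: indicator_def)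

text \<open>Conditioning on the shelf and the placement of the first card dealt. The function \<open>g\<close> keeps the
  observed feature of the final piles fixed, so that the equation can be iterated.\<close>

lemma pmf_map_deal_cards_Cons:
  assumes "m \<ge> 1" "p \<in> {0..1}"
  shows "pmf (map_pmf g (deal_cards m p (c # cs) P)) x =
    (\<Sum>j = 1..m. p * pmf (map_pmf g (deal_cards m p cs (place_card c j True P))) x
        + (1 - p) * pmf (map_pmf g (deal_cards m p cs (place_card c j False P))) x) / real m"
  using assms
  by (simp add: deal_card_def map_bind_pmf bind_assoc_pmf bind_return_pmf pmf_bind
      integral_pmf_of_set mult.commute)

text \<open>If \<open>S c\<close> is the shelf of card \<open>c\<close>, the joined deck lists the cards by increasing shelf number and
  keeps the order inside each pile: it is the result of a stable sort with key \<open>S\<close>. A list sorted by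
  \<open>S\<close> is determined by its sublists with constant key, so a target deck can be tested pile by pile.\<close>

lemma join_piles_eq_iff:
  assumes piles: "\<And>i c. c \<in> set (P i) \<Longrightarrow> i \<in> {1..m} \<and> S c = i"
    and range: "S ` set xs \<subseteq> {1..m}"
  shows "join_piles m P = xs \<longleftrightarrow>
    sorted (map S xs) \<and> (\<forall>i. filter (\<lambda>c. S c = i) xs = P i)"
proof -
  have filter_concat: "filter (\<lambda>c. S c = i) (concat (map P js)) = (if i \<in> set js then P i else [])"
    if "distinct js" for i js
    using that
  proof (induction js)
    case (Cons j js)
    have "filter (\<lambda>c. S c = i) (P j) = (if i = j then P j else [])"
      using piles by (auto simp: filter_empty_conv intro!: filter_True)
    then show ?case using Cons by auto
  qed simp
  have outside: "P i = []" if "i \<notin> {1..m}" for i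
    using piles[of _ i] that by (cases "P i") auto
  have filter_join: "filter (\<lambda>c. S c = i) (join_piles m P) = P i" for i
    unfolding join_piles_def by (subst filter_concat) (auto simp: outside)
  have sorted_concat: "sorted (map S (concat (map P js)))" if "sorted js" for js
    using that
  proof (induction js)
    case (Cons j js)
    have "map S (P j) = replicate (length (P j)) j"
      using piles by (auto simp: list_eq_iff_nth_eq)
    moreover have "\<forall>c \<in> set (concat (map P js)). j \<le> S c"
      using Cons.prems piles by fastforce
    ultimately show ?case
      using Cons by (auto simp: sorted_append)
  qed simp
  have sorted_join: "sorted (map S (join_piles m P))"
    unfolding join_piles_def by (intro sorted_concat sorted_upt)
  show ?thesis
  proof
    assume "join_piles m P = xs"
    then show "sorted (map S xs) \<and> (\<forall>i. filter (\<lambda>c. S c = i) xs = P i)"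
      using sorted_join filter_join by auto
  next
    assume R: "sorted (map S xs) \<and> (\<forall>i. filter (\<lambda>c. S c = i) xs = P i)"
    then have same: "filter (\<lambda>c. S c = i) xs = filter (\<lambda>c. S c = i) (join_piles m P)" for i
      by (simp add: filter_join)
    \<comment> \<open>The copies of a card all lie in the sublist of its own key.\<close>
    have "mset xs = mset (join_piles m P)"
    proof (rule multiset_eqI)
      fix c
      have "count (mset ys) c = count (mset (filter (\<lambda>d. S d = S c) ys)) c" for ys
        by simp
      then show "count (mset xs) c = count (mset (join_piles m P)) c"
        using same by metis
    qed
    then have "sort_key S (join_piles m P) = xs"
      using R same by (intro properties_for_sort_key) (auto simp: eq_commute)
    moreover have "sort_key S (join_piles m P) = join_piles m P"
      using sorted_join by (simp add: sorted_sort_id sort_key_id_if_sorted)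
    ultimately show "join_piles m P = xs" by simp
  qed
qed

section \<open>The probability of 213 under a shelf shuffle\<close>

text \<open>Only the placement of card 1 is constrained: card 3 starts its pile, and cards 2 and 3 could share a
  shelf only together with card 1, for which the two requirements on \<open>b1\<close> contradict each other.\<close>

lemma join_piles_eq_213_iff:
  assumes "j1 \<in> {1..m}" "j2 \<in> {1..m}" "j3 \<in> {1..m}"
  shows "join_piles m (place_card 1 j1 b1 (place_card 2 j2 b2 (place_card 3 j3 b3 (\<lambda>_. [])))) = [2, 1, 3]
    \<longleftrightarrow> j2 \<le> j1 \<and> j1 \<le> j3 \<and> (j1 = j2 \<longrightarrow> \<not> b1) \<and> (j1 = j3 \<longrightarrow> b1)"
proof -
  define S where "S = (\<lambda>c::nat. if c = 1 then j1 else if c = 2 then j2 else j3)"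
  show ?thesis
    by (subst join_piles_eq_iff[where S = S])
       (use assms in \<open>auto simp: place_card_def S_def split: if_splits\<close>)
qed

text \<open>This is where the placement probability cancels. Card 1 goes to the top with probability \<open>s\<close>
  and then yields 213 for the shelves \<open>j2 < j1 \<le> j3\<close>; it goes to the bottom with probability
  \<open>1 - s\<close> and then needs \<open>j2 \<le> j1 < j3\<close>. Both half-open intervals contain \<open>j3 - j2\<close> shelves. The
  truncated subtraction is meant: both intervals are empty if \<open>j3 \<le> j2\<close>.\<close>

lemma sum_weight_213:
  fixes s :: real
  assumes "j3 \<in> {1..m}" "j2 \<in> {1..m}"
  shows "(\<Sum>j1 = 1..m.
      s * of_bool (j2 \<le> j1 \<and> j1 \<le> j3 \<and> j1 \<noteq> j2) +
      (1 - s) * of_bool (j2 \<le> j1 \<and> j1 \<le> j3 \<and> j1 \<noteq> j3)) = real (j3 - j2)"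
proof -
  have "{1..m} \<inter> {j1. j2 \<le> j1 \<and> j1 \<le> j3 \<and> j1 \<noteq> j2} = {j2<..j3}"
       "{1..m} \<inter> {j1. j2 \<le> j1 \<and> j1 \<le> j3 \<and> j1 \<noteq> j3} = {j2..<j3}"
    using assms by auto
  then show ?thesis
    by (simp add: sum.distrib flip: sum_distrib_left) (simp add: algebra_simps)
qed

lemma sum_differences: "(\<Sum>k = 1..m. \<Sum>j = 1..m. real (k - j)) = real m * (real m ^ 2 - 1) / 6"
proof -
  have inner: "(\<Sum>j = 1..m. real (k - j)) = real k * (real k - 1) / 2" if "k \<in> {1..m}" for k
  proof -
    have "(\<Sum>j = 1..m. real (k - j)) = (\<Sum>j = 1..k. real k - real j)"
      using that by (intro sum.mono_neutral_cong_right) (auto simp: of_nat_diff)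
    also have "\<dots> = real k * (real k - 1) / 2"
      using double_gauss_sum_from_Suc_0[of k, where 'a = real]
      by (simp add: sum_subtractf field_simps)
    finally show ?thesis .
  qed
  have "(\<Sum>k = 1..m. real k * (real k - 1) / 2) = real m * (real m ^ 2 - 1) / 6"
    by (induction m) (auto simp: field_simps power2_eq_square)
  then show ?thesis
    by (simp only: inner cong: sum.cong)
qed

lemma length_join_piles_place_card:
  assumes "j \<in> {1..m}"
  shows "length (join_piles m (place_card c j b P)) = Suc (length (join_piles m P))"
proof -
  have length_join: "length (join_piles m Q) = (\<Sum>i = 1..m. length (Q i))" for Q
    by (simp add: join_piles_def length_concat comp_def interv_sum_list_conv_sum_set_nat
        atLeastLessThanSuc_atLeastAtMost del: upt_Suc)
  have "(\<Sum>i \<in> {1..m} - {j}. length (place_card c j b P i)) = (\<Sum>i \<in> {1..m} - {j}. length (P i))"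
    by (intro sum.cong) (auto simp: place_card_def)
  then show ?thesis
    using assms by (simp add: length_join sum.remove[of _ j] place_card_def)
qed

text \<open>The cards 3, 2, 1 are dealt in this order; the probability is computed from the last card
  backwards. Only the choice of shelf affects the outcome for cards 3 and 2, so their two placements
  average out.\<close>

lemma pmf_shelf_shuffle_213:
  assumes "m \<ge> 1" "s \<in> {0..1}"
  shows "pmf (shelf_shuffle 3 m s) (perm_of_one_line [2, 1, 3]) = (1 - 1 / real m ^ 2) / 6"
proof -
  let ?g = "\<lambda>P. perm_of_one_line (join_piles m P)"
  let ?\<pi> = "perm_of_one_line [2, 1, 3]"
  let ?E = "\<lambda>_. [] :: nat list"
  have same: "s * a + (1 - s) * a = a" for a :: real
    by (simp add: algebra_simps)
  have last: "pmf (map_pmf ?g (deal_cards m s [1] (place_card 2 j2 b2 (place_card 3 j3 b3 ?E)))) ?\<pi>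
      = real (j3 - j2) / real m" if j: "j3 \<in> {1..m}" "j2 \<in> {1..m}" for j3 j2 b3 b2
  proof -
    have "?g (place_card 1 j1 b1 (place_card 2 j2 b2 (place_card 3 j3 b3 ?E))) = ?\<pi> \<longleftrightarrow>
        j2 \<le> j1 \<and> j1 \<le> j3 \<and> (j1 = j2 \<longrightarrow> \<not> b1) \<and> (j1 = j3 \<longrightarrow> b1)"
      if "j1 \<in> {1..m}" for j1 b1
    proof -
      have "length (join_piles m (place_card 1 j1 b1 (place_card 2 j2 b2 (place_card 3 j3 b3 ?E)))) = 3"
        using j that by (simp add: length_join_piles_place_card) (simp add: join_piles_def)
      then show ?thesis
        using j that by (subst perm_of_one_line_eq_iff) (simp_all only: join_piles_eq_213_iff, simp)
    qed
    then show ?thesis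
      unfolding pmf_map_deal_cards_Cons[OF assms] pmf_map_deal_cards_Nil
        sum_weight_213[OF j, of s, symmetric]
      by (intro arg_cong2[where f = "(/)"] sum.cong refl) simp
  qed
  have middle: "pmf (map_pmf ?g (deal_cards m s [2, 1] (place_card 3 j3 b3 ?E))) ?\<pi>
      = (\<Sum>j2 = 1..m. real (j3 - j2)) / real m ^ 2" if "j3 \<in> {1..m}" for j3 b3
  proof -
    have "pmf (map_pmf ?g (deal_cards m s [2, 1] (place_card 3 j3 b3 ?E))) ?\<pi>
      = (\<Sum>j2 = 1..m. real (j3 - j2) / real m) / real m"
      unfolding pmf_map_deal_cards_Cons[OF assms, of _ 2]
      using that by (intro arg_cong2[where f = "(/)"] sum.cong refl) (simp only: last same)
    then show ?thesis
      by (simp add: power2_eq_square flip: sum_divide_distrib)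
  qed
  have "pmf (map_pmf ?g (deal_cards m s [3, 2, 1] ?E)) ?\<pi>
      = (\<Sum>j3 = 1..m. (\<Sum>j2 = 1..m. real (j3 - j2)) / real m ^ 2) / real m"
    unfolding pmf_map_deal_cards_Cons[OF assms, of _ 3]
    by (intro arg_cong2[where f = "(/)"] sum.cong refl) (simp only: middle same)
  also have "\<dots> = (real m * (real m ^ 2 - 1) / 6) / real m ^ 2 / real m"
    by (simp only: sum_differences flip: sum_divide_distrib)
  also have "\<dots> = (1 - 1 / real m ^ 2) / 6"
    using assms(1) by (simp add: field_simps)
  finally show ?thesis
    by (simp add: shelf_shuffle_def upt_rec numeral_eq_Suc)
qed

section \<open>Two rounds with a single shelf\<close>

text \<open>With one shelf, the pile starts with card 3, and the four placements of cards 2 and 1 give four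
  different decks.\<close>

lemma pmf_shelf_shuffle_one_shelf:
  assumes "p \<in> {0..1}"
  shows "pmf (shelf_shuffle 3 1 p) \<pi> =
    p\<^sup>2 * of_bool (\<pi> = perm_of_one_line [1, 2, 3]) +
    p * (1 - p) * of_bool (\<pi> = perm_of_one_line [1, 3, 2]) +
    p * (1 - p) * of_bool (\<pi> = perm_of_one_line [2, 3, 1]) +
    (1 - p)\<^sup>2 * of_bool (\<pi> = perm_of_one_line [3, 2, 1])"
proof -
  have deal: "rev [1..<3 + 1] = [3, 2, 1::nat]"
    by (simp add: upt_rec numeral_eq_Suc)
  show ?thesis
    unfolding shelf_shuffle_def deal
    using assms
    by (simp only: pmf_map_deal_cards_Cons pmf_map_deal_cards_Nil)
       (simp add: join_piles_def place_card_def power2_eq_square algebra_simps eq_commute[of \<pi>])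
qed

text \<open>Among the products of the four permutations in the support, 213 arises exactly as
  \<open>231 \<circ> 132\<close> and as \<open>321 \<circ> 231\<close>, which contribute \<open>p\<^sup>2 (1 - p)\<^sup>2\<close> and \<open>p (1 - p)\<^sup>3\<close>.\<close>

lemma perm_convolution_one_shelf_213:
  assumes "p \<in> {0..1}"
  shows "perm_convolution 3 (shelf_shuffle 3 1 p) (shelf_shuffle 3 1 p) (perm_of_one_line [2, 1, 3])
    = p * (1 - p)\<^sup>2"
proof -
  let ?\<mu> = "shelf_shuffle 3 1 p"
  let ?f = "\<lambda>(\<sigma>, \<tau>). pmf ?\<mu> \<sigma> * pmf ?\<mu> \<tau>"
  let ?S = "{(\<sigma>, \<tau>). \<sigma> permutes {1..3} \<and> \<tau> permutes {1..3} \<and> \<sigma> \<circ> \<tau> = perm_of_one_line [2, 1, 3]}"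
  let ?T = "{(perm_of_one_line [2, 3, 1], perm_of_one_line [1, 3, 2]),
             (perm_of_one_line [3, 2, 1], perm_of_one_line [2, 3, 1])}"
  have "finite ?S"
    by (rule finite_subset[OF _ finite_cartesian_product[OF finite_permutations finite_permutations,
          of "{1..3}" "{1..3}"]]) auto
  moreover have "?T \<subseteq> ?S"
  proof -
    have "perm_of_one_line [1, 3, 2] permutes {1..3}" "perm_of_one_line [2, 3, 1] permutes {1..3}"
         "perm_of_one_line [3, 2, 1] permutes {1..3}"
      using perm_of_one_line_permutes[of "[1, 3, 2]"] perm_of_one_line_permutes[of "[2, 3, 1]"]
        perm_of_one_line_permutes[of "[3, 2, 1]"]
      by (simp_all add: numeral_eq_Suc atLeastAtMostSuc_conv insert_commute)
    then show ?thesis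
      by (simp add: perm_of_one_line_comp)
  qed
  moreover have "?f (\<sigma>, \<tau>) = 0" if "(\<sigma>, \<tau>) \<in> ?S - ?T" for \<sigma> \<tau>
  proof (rule ccontr)
    assume "?f (\<sigma>, \<tau>) \<noteq> 0"
    then have "pmf ?\<mu> \<sigma> \<noteq> 0" "pmf ?\<mu> \<tau> \<noteq> 0"
      by auto
    then have "\<sigma> \<in> perm_of_one_line ` {[1, 2, 3], [1, 3, 2], [2, 3, 1], [3, 2, 1]}"
              "\<tau> \<in> perm_of_one_line ` {[1, 2, 3], [1, 3, 2], [2, 3, 1], [3, 2, 1]}"
      unfolding pmf_shelf_shuffle_one_shelf[OF assms] by (auto split: if_splits)
    moreover have "\<sigma> \<circ> \<tau> = perm_of_one_line [2, 1, 3]" "(\<sigma>, \<tau>) \<notin> ?T"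
      using that by auto
    ultimately show False
      by (auto simp: perm_of_one_line_comp perm_of_one_line_eq_iff)
  qed
  ultimately have "sum ?f ?S = sum ?f ?T"
    by (intro sum.mono_neutral_right) blast+
  also have "\<dots> = (p * (1 - p)) * (p * (1 - p)) + (1 - p)\<^sup>2 * (p * (1 - p))"
    by (simp add: pmf_shelf_shuffle_one_shelf[OF assms] perm_of_one_line_eq_iff del: One_nat_def)
  also have "\<dots> = p * (1 - p)\<^sup>2"
    by (simp add: power2_eq_square algebra_simps)
  finally show ?thesis
    by (simp add: perm_convolution_def)
qed

theorem proposition1p9:
  "\<exists>(n::nat) (m::nat) (p::real). n \<ge> 1 \<and> m \<ge> 1 \<and> p \<in> {0<..<1} \<and>
     (\<forall>(m'::nat) (s::real). m' \<ge> 1 \<longrightarrow> s \<in> {0<..<1} \<longrightarrow>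
        \<not> (\<forall>\<pi>. \<pi> permutes {1..n} \<longrightarrow>
              perm_convolution n (shelf_shuffle n m p) (shelf_shuffle n m p) \<pi>
                = pmf (shelf_shuffle n m' s) \<pi>))"
proof -
  have "\<not> (\<forall>\<pi>. \<pi> permutes {1..3} \<longrightarrow>
      perm_convolution 3 (shelf_shuffle 3 1 (3/4)) (shelf_shuffle 3 1 (3/4)) \<pi>
        = pmf (shelf_shuffle 3 m' s) \<pi>)" if m': "m' \<ge> 1" and s: "s \<in> {0<..<1}" for m' :: nat and s :: real
  proof
    assume equal: "\<forall>\<pi>. \<pi> permutes {1..3} \<longrightarrow>
      perm_convolution 3 (shelf_shuffle 3 1 (3/4)) (shelf_shuffle 3 1 (3/4)) \<pi>
        = pmf (shelf_shuffle 3 m' s) \<pi>"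
    have "perm_of_one_line [2, 1, 3] permutes {1..3}"
      using perm_of_one_line_permutes[of "[2, 1, 3]"]
      by (simp add: numeral_eq_Suc atLeastAtMostSuc_conv insert_commute)
    with equal have "perm_convolution 3 (shelf_shuffle 3 1 (3/4)) (shelf_shuffle 3 1 (3/4))
        (perm_of_one_line [2, 1, 3]) = pmf (shelf_shuffle 3 m' s) (perm_of_one_line [2, 1, 3])"
      by blast
    moreover have "perm_convolution 3 (shelf_shuffle 3 1 (3/4)) (shelf_shuffle 3 1 (3/4))
        (perm_of_one_line [2, 1, 3]) = 3/4 * (1 - 3/4)\<^sup>2"
      by (rule perm_convolution_one_shelf_213) simp
    moreover have "pmf (shelf_shuffle 3 m' s) (perm_of_one_line [2, 1, 3]) = (1 - 1 / real m' ^ 2) / 6"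
      using m' s by (intro pmf_shelf_shuffle_213) auto
    ultimately have "3/4 * (1 - 3/4)\<^sup>2 = (1 - 1 / real m' ^ 2) / 6"
      by (simp only:)
    then have square: "1 / real m' ^ 2 = 23 / 32"
      by (simp add: power2_eq_square)
    show False
    proof (cases "m' = 1")
      case False
      \<comment> \<open>With one shelf the left-hand side is 1, with at least two it is at most 1/4.\<close>
      with m' have "2\<^sup>2 \<le> real m' ^ 2"
        by (intro power_mono) auto
      then have "1 / real m' ^ 2 \<le> 1 / 4"
        using m' by (intro divide_left_mono) auto
      with square show False by simp
    qed (use square in simp)
  qed
  then show ?thesis
    by (intro exI[of _ 3] exI[of _ 1] exI[of _ "3/4"]) auto
qed

end
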